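(* Let $(\Omega,\Sigma,\mu)$ be a complete finite measure space and $X(\mu)$ a Banach function space. The (not necessarily linear) operator $T:X(\mu)\to L^0(\mu)$ is lattice Lipschitz if and only if there exists a function $\Phi:\Omega\to Lip_0(\mathbb R)$ such that (a) for every $f\in X(\mu)$, $T(f)(w)=\Phi(w)(f(w))$ for $\mu$-almost every $w\in\Omega$, and (b) for every $p\in\mathfrak F(\mathbb R)$, the function $p\circ\Phi:\Omega\to\mathbb R$, $w\mapsto\langle \Phi(w),p\rangle$, is $\mu$-measurable.
   Context: All functions are real-valued; $L^0(\mu)$ is the space of $\mu$-a.e. classes of measurable real functions on $\Omega$. A Banach function space $X(\mu)$ is a linear subspace of $L^0(\mu)$ which is an ideal for the $\mu$-a.e. order (if $|f|\le|g|$ a.e., $f\in L^0(\mu)$, $g\in X(\mu)$, then $f\in X(\mu)$), is a Banach space, satisfies $\|f\|\le\|g\|$ whenever $f,g\in X(\mu)$, $|f|\le|g|$ a.e., and contains $\chi_\Omega$. An operator $T:X(\mu)\to L^0(\mu)$ is lattice Lipschitz if there is a function $K:\Omega\to[0,\infty)$ (not assumed measurable) such that for every $f,g\in X(\mu)$, $|T(f)(w)-T(g)(w)|\le K(w)|f(w)-g(w)|$ for $\mu$-a.e. $w\in\Omega$ (the exceptional null set may depend on $f,g$). $Lip_0(\mathbb R)$ is the Banach space of Lipschitz functions $\varphi:\mathbb R\to\mathbb R$ with $\varphi(0)=0$, normed by the Lipschitz constant. The Lipschitz-free space $\mathfrak F(\mathbb R)$ is the norm-closed linear span in $(Lip_0(\mathbb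 R))^*$ of the evaluation functionals $\delta_x(\varphi)=\varphi(x)$, $x\in\mathbb R$; its dual is $Lip_0(\mathbb R)$.
   Formalization: The equivalence is proved with "T is lattice Lipschitz and T(0)=0 almost everywhere" in place of "T is lattice Lipschitz"; without T(0)=0 the claim fails, e.g. for T(f)=f+1, since every function in Lip_0(R) vanishes at 0. *)

theory Defs
  imports "HOL-Analysis.Analysis"
begin

typedef lip0 = "{\<phi> :: real \<Rightarrow> real. \<phi> 0 = 0 \<and> (\<exists>C. C-lipschitz_on UNIV \<phi>)}"
  morphisms lip0_fun Abs_lip0
  by (rule exI[of _ "\<lambda>_. 0"]) (auto intro: exI[of _ 0] simp: lipschitz_on_def)

setup_lifting type_definition_lip0

instantiation lip0 :: real_vector
begin

lift_definition zero_lip0 :: lip0 is "\<lambda>_. 0"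
  by (auto intro: exI[of _ 0] simp: lipschitz_on_def)

lift_definition plus_lip0 :: "lip0 \<Rightarrow> lip0 \<Rightarrow> lip0" is "\<lambda>\<phi> \<psi> x. \<phi> x + \<psi> x"
  by (auto intro: lipschitz_on_add)

lift_definition minus_lip0 :: "lip0 \<Rightarrow> lip0 \<Rightarrow> lip0" is "\<lambda>\<phi> \<psi> x. \<phi> x - \<psi> x"
  by (auto intro: lipschitz_on_diff)

lift_definition uminus_lip0 :: "lip0 \<Rightarrow> lip0" is "\<lambda>\<phi> x. - \<phi> x"
  by (auto simp: lipschitz_on_def dist_minus)

lift_definition scaleR_lip0 :: "real \<Rightarrow> lip0 \<Rightarrow> lip0" is "\<lambda>c \<phi> x. c * \<phi> x"
  by (auto intro: lipschitz_on_cmult_real)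

instance
  by standard (transfer; simp add: algebra_simps fun_eq_iff)+

end

instantiation lip0 :: real_normed_vector
begin

lift_definition norm_lip0 :: "lip0 \<Rightarrow> real" is "\<lambda>\<phi>. Inf {C. C-lipschitz_on UNIV \<phi>}" .

definition dist_lip0 :: "lip0 \<Rightarrow> lip0 \<Rightarrow> real"
  where "dist_lip0 \<phi> \<psi> = norm (\<phi> - \<psi>)"

definition sgn_lip0 :: "lip0 \<Rightarrow> lip0"
  where "sgn_lip0 \<phi> = \<phi> /\<^sub>R norm \<phi>"

definition uniformity_lip0 :: "(lip0 \<times> lip0) filter"
  where "uniformity_lip0 = (INF e\<in>{0 <..}. principal {(x, y). dist x y < e})"

definition open_lip0 :: "lip0 set \<Rightarrow> bool"
  where "open_lip0 U = (\<forall>x\<in>U. \<forall>\<^sub>F (x', y) in uniformity. x' = x \<longrightarrow> y \<in> U)"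

lemma norm_lip0_le: "C-lipschitz_on UNIV (lip0_fun \<phi>) \<Longrightarrow> norm \<phi> \<le> C"
  unfolding norm_lip0.rep_eq
  by (rule cInf_lower) (auto intro!: bdd_belowI[of _ 0] dest: lipschitz_on_nonneg)

lemma lipschitz_on_norm_lip0: "(norm \<phi>)-lipschitz_on UNIV (lip0_fun \<phi>)"
proof (rule lipschitz_onI)
  let ?S = "{C. C-lipschitz_on UNIV (lip0_fun \<phi>)}"
  have ne: "?S \<noteq> {}"
    using lip0_fun[of \<phi>] by auto
  show "0 \<le> norm \<phi>"
    unfolding norm_lip0.rep_eq by (rule cInf_greatest[OF ne]) (auto dest: lipschitz_on_nonneg)
  fix x y :: real
  show "dist (lip0_fun \<phi> x) (lip0_fun \<phi> y) \<le> norm \<phi> * dist x y"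
  proof (cases "x = y")
    case False
    have "dist (lip0_fun \<phi> x) (lip0_fun \<phi> y) / dist x y \<le> norm \<phi>"
      unfolding norm_lip0.rep_eq
    proof (rule cInf_greatest[OF ne])
      fix C assume "C \<in> ?S"
      then show "dist (lip0_fun \<phi> x) (lip0_fun \<phi> y) / dist x y \<le> C"
        using False by (auto simp: divide_le_eq dest: lipschitz_onD)
    qed
    then show ?thesis
      using False by (simp add: divide_le_eq)
  qed simp
qed

lemma lip0_fun_0 [simp]: "lip0_fun \<phi> 0 = 0"
  using lip0_fun[of \<phi>] by simp

lemma abs_lip0_fun_le: "\<bar>lip0_fun \<phi> x\<bar> \<le> norm \<phi> * \<bar>x\<bar>"
  using lipschitz_onD[OF lipschitz_on_norm_lip0, of x 0 \<phi>] by (simp add: dist_real_def)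

lemma norm_scaleR_lip0_le: "norm (c *\<^sub>R \<phi>) \<le> \<bar>c\<bar> * norm (\<phi> :: lip0)"
  by (rule norm_lip0_le)
    (auto simp: scaleR_lip0.rep_eq intro: lipschitz_on_cmult_real lipschitz_on_norm_lip0)

instance
proof
  fix \<phi> \<psi> :: lip0 and c :: real
  show "dist \<phi> \<psi> = norm (\<phi> - \<psi>)" "sgn \<phi> = \<phi> /\<^sub>R norm \<phi>"
    by (simp_all add: dist_lip0_def sgn_lip0_def)
  show "(uniformity :: (lip0 \<times> lip0) filter) = (INF e\<in>{0 <..}. principal {(x, y). dist x y < e})"
    by (rule uniformity_lip0_def)
  show "open U = (\<forall>x\<in>U. \<forall>\<^sub>F (x', y) in uniformity. x' = x \<longrightarrow> y \<in> U)" for U :: "lip0 set"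
    by (rule open_lip0_def)
  show "norm \<phi> = 0 \<longleftrightarrow> \<phi> = 0"
  proof
    assume "norm \<phi> = 0"
    then have "lip0_fun \<phi> x = lip0_fun 0 x" for x
      using abs_lip0_fun_le[of \<phi> x] by (simp add: zero_lip0.rep_eq)
    then show "\<phi> = 0"
      by (auto simp: lip0_fun_inject[symmetric])
  next
    assume "\<phi> = 0"
    then have "norm \<phi> \<le> 0"
      by (intro norm_lip0_le) (simp add: zero_lip0.rep_eq lipschitz_on_def)
    then show "norm \<phi> = 0"
      using lipschitz_on_nonneg[OF lipschitz_on_norm_lip0, of \<phi>] by simp
  qed
  show "norm (\<phi> + \<psi>) \<le> norm \<phi> + norm \<psi>"
    by (rule norm_lip0_le)
      (auto simp: plus_lip0.rep_eq intro: lipschitz_on_add lipschitz_on_norm_lip0)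
  show "norm (c *\<^sub>R \<phi>) = \<bar>c\<bar> * norm \<phi>"
  proof (cases "c = 0")
    case True
    then show ?thesis
      using norm_scaleR_lip0_le[of c \<phi>]
        lipschitz_on_nonneg[OF lipschitz_on_norm_lip0, of "c *\<^sub>R \<phi>"] by simp
  next
    case False
    then have "\<bar>c\<bar> * norm \<phi> \<le> norm (c *\<^sub>R \<phi>)"
      using norm_scaleR_lip0_le[of "inverse c" "c *\<^sub>R \<phi>"]
      by (simp add: field_simps abs_inverse)
    then show ?thesis
      using norm_scaleR_lip0_le[of c \<phi>] by simp
  qed
qed

end

lift_definition lip0_eval :: "real \<Rightarrow> lip0 \<Rightarrow>\<^sub>L real" is "\<lambda>x \<phi>. lip0_fun \<phi> x"
proof -
  fix x :: real
  show "bounded_linear (\<lambda>\<phi>. lip0_fun \<phi> x)"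
    by (rule bounded_linear_intro[where K = "\<bar>x\<bar>"])
      (auto simp: plus_lip0.rep_eq scaleR_lip0.rep_eq abs_lip0_fun_le)
qed

text \<open>The Lipschitz-free space \<open>F(\<real>)\<close>, as a subset of the dual of \<open>lip0\<close>. The pairing of
  \<open>p\<close> in it with \<open>\<phi> :: lip0\<close> is therefore \<open>blinfun_apply p \<phi>\<close>.\<close>

definition lipschitz_free_space :: "(lip0 \<Rightarrow>\<^sub>L real) set"
  where "lipschitz_free_space = closure (span (range lip0_eval))"

text \<open>Elements of \<open>L\<^sup>0(M)\<close> are represented by measurable functions, equality being
  \<open>M\<close>-a.e. equality. A Banach function space is the set \<open>X\<close> of all representatives of its
  elements (\<open>ideal\<close> makes \<open>X\<close> closed under a.e. equality) with its norm \<open>N\<close> as a function of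
  the representative (\<open>norm_mono\<close> makes \<open>N\<close> invariant under a.e. equality).
  Values outside \<open>space M\<close> are irrelevant.\<close>

locale banach_function_space =
  fixes M :: "'a measure" and X :: "('a \<Rightarrow> real) set" and N :: "('a \<Rightarrow> real) \<Rightarrow> real"
  assumes measurable: "X \<subseteq> borel_measurable M"
    and add_mem: "f \<in> X \<Longrightarrow> g \<in> X \<Longrightarrow> (\<lambda>w. f w + g w) \<in> X"
    and scale_mem: "f \<in> X \<Longrightarrow> (\<lambda>w. c * f w) \<in> X"
    and ideal: "f \<in> borel_measurable M \<Longrightarrow> g \<in> X \<Longrightarrow> AE w in M. \<bar>f w\<bar> \<le> \<bar>g w\<bar> \<Longrightarrow> f \<in> X"
    and indicator_mem: "indicator (space M) \<in> X"
    and norm_nonneg: "f \<in> X \<Longrightarrow> 0 \<le> N f"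
    and norm_eq_0_iff: "f \<in> X \<Longrightarrow> N f = 0 \<longleftrightarrow> (AE w in M. f w = 0)"
    and norm_scale: "f \<in> X \<Longrightarrow> N (\<lambda>w. c * f w) = \<bar>c\<bar> * N f"
    and norm_triangle: "f \<in> X \<Longrightarrow> g \<in> X \<Longrightarrow> N (\<lambda>w. f w + g w) \<le> N f + N g"
    and norm_mono: "f \<in> X \<Longrightarrow> g \<in> X \<Longrightarrow> AE w in M. \<bar>f w\<bar> \<le> \<bar>g w\<bar> \<Longrightarrow> N f \<le> N g"
    and norm_complete:
      "(\<And>n. F n \<in> X) \<Longrightarrow>
       (\<And>e. e > 0 \<Longrightarrow> \<exists>k. \<forall>m\<ge>k. \<forall>n\<ge>k. N (\<lambda>w. F m w - F n w) < e) \<Longrightarrow>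
       \<exists>f\<in>X. (\<lambda>n. N (\<lambda>w. F n w - f w)) \<longlonglongrightarrow> 0"

text \<open>A map \<open>X \<rightarrow> L\<^sup>0(M)\<close>, given on representatives.\<close>

definition L0_operator :: "'a measure \<Rightarrow> ('a \<Rightarrow> real) set \<Rightarrow> (('a \<Rightarrow> real) \<Rightarrow> 'a \<Rightarrow> real) \<Rightarrow> bool"
  where "L0_operator M X T \<longleftrightarrow>
    (\<forall>f\<in>X. T f \<in> borel_measurable M) \<and>
    (\<forall>f\<in>X. \<forall>g\<in>X. (AE w in M. f w = g w) \<longrightarrow> (AE w in M. T f w = T g w))"

definition lattice_lipschitz ::
    "'a measure \<Rightarrow> ('a \<Rightarrow> real) set \<Rightarrow> (('a \<Rightarrow> real) \<Rightarrow> 'a \<Rightarrow> real) \<Rightarrow> bool"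
  where "lattice_lipschitz M X T \<longleftrightarrow>
    (\<exists>K :: 'a \<Rightarrow> real. (\<forall>w\<in>space M. 0 \<le> K w) \<and>
      (\<forall>f\<in>X. \<forall>g\<in>X. AE w in M. \<bar>T f w - T g w\<bar> \<le> K w * \<bar>f w - g w\<bar>))"

end

(* A lattice Lipschitz operator acts on the rational constants q, for almost every w, by
   a K w-Lipschitz function q |-> T q w; its extension to the reals is Phi w. The Lipschitz estimate
   between f and the constants q then passes from rational q to q = f w, where it reads
   T f w = Phi w (f w). Conversely the Lipschitz constant of Phi w serves as K w. *)

theory Submission
  imports Defs
begin

text \<open>Preimages of a Borel set under \<open>f\<close> and \<open>g\<close> differ by a null
  set, and completeness makes such a modification measurable.\<close>

lemma (in complete_measure) borel_measurable_AE_eq: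
  fixes f g :: "'a \<Rightarrow> 'b::topological_space"
  assumes f: "f \<in> borel_measurable M" and eq: "AE w in M. f w = g w"
  shows "g \<in> borel_measurable M"
proof (rule measurableI)
  fix A :: "'b set" assume A: "A \<in> sets borel"
  show "g -` A \<inter> space M \<in> sets M"
  proof (rule in_sets_AE)
    show "AE w in M. w \<in> f -` A \<inter> space M \<longleftrightarrow> w \<in> g -` A \<inter> space M"
      using eq by eventually_elim auto
    show "f -` A \<inter> space M \<in> sets M"
      using f A by (rule measurable_sets)
  qed auto
qed simp

lemma (in banach_function_space) const_mem: "(\<lambda>_. c) \<in> X"
proof (rule ideal)
  show "(\<lambda>w. c * indicator (space M) w) \<in> X"
    by (rule scale_mem[OF indicator_mem])
  show "AE w in M. \<bar>c\<bar> \<le> \<bar>c * indicator (space M) w\<bar>"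
    by (rule AE_I2) simp
qed simp

text \<open>A Lipschitz map extends to the closure of its domain with the same constant, and the
  rationals are dense. Since 0 is rational, the extension still vanishes there.\<close>

lemma lip0_extend_Rats:
  assumes "C-lipschitz_on \<rat> h" and "h 0 = 0"
  obtains \<phi> where "\<forall>q\<in>\<rat>. lip0_fun \<phi> q = h q"
proof -
  obtain g where g: "C-lipschitz_on UNIV g" "\<And>q. q \<in> \<rat> \<Longrightarrow> g q = h q"
    using lipschitz_extend_closure[OF assms(1)] by (auto simp: Rats_closure_real)
  then have "lip0_fun (Abs_lip0 g) = g"
    using assms(2) by (intro Abs_lip0_inverse) auto
  with g(2) show ?thesis
    by (intro that[of "Abs_lip0 g"]) simp
qed

text \<open>Both sides of the bound are continuous in \<open>q\<close>, so it holds on a closed set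
  containing the dense rationals, hence at \<open>q = x\<close>, where the right-hand side is
  0.\<close>

lemma lip0_fun_eq_of_Rats_bound:
  assumes "\<And>q. q \<in> \<rat> \<Longrightarrow> \<bar>t - lip0_fun \<phi> q\<bar> \<le> C * \<bar>x - q\<bar>"
  shows "t = lip0_fun \<phi> x"
proof -
  let ?S = "{y. \<bar>t - lip0_fun \<phi> y\<bar> \<le> C * \<bar>x - y\<bar>}"
  have "continuous_on UNIV (lip0_fun \<phi>)"
    by (rule lipschitz_on_continuous_on[OF lipschitz_on_norm_lip0])
  then have "closed ?S"
    by (intro closed_Collect_le continuous_intros)
  then have "closure \<rat> \<subseteq> ?S"
    using assms by (intro closure_minimal) auto
  then have "x \<in> ?S"
    unfolding Rats_closure_real by (rule subsetD) simp
  then show ?thesis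
    by simp
qed

text \<open>The functionals with measurable pairing form a subspace containing the evaluations. Norm
  convergence of functionals gives pointwise convergence of the pairings, so measurability survives
  passing to the closure.\<close>

lemma lipschitz_free_pairing_measurable:
  assumes eval: "\<And>x. (\<lambda>w. lip0_fun (\<Phi> w) x) \<in> borel_measurable M"
    and p: "p \<in> lipschitz_free_space"
  shows "(\<lambda>w. blinfun_apply p (\<Phi> w)) \<in> borel_measurable M"
proof -
  let ?S = "{p :: lip0 \<Rightarrow>\<^sub>L real. (\<lambda>w. blinfun_apply p (\<Phi> w)) \<in> borel_measurable M}"
  have "range lip0_eval \<subseteq> ?S"
    using eval by (auto simp: lip0_eval.rep_eq)
  moreover have "subspace ?S"
    by (auto simp: subspace_def blinfun.add_left blinfun.scaleR_left)
  ultimately have span: "span (range lip0_eval) \<subseteq> ?S"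
    by (rule span_minimal)
  obtain P where P: "\<And>n. P n \<in> span (range lip0_eval)" "P \<longlonglongrightarrow> p"
    using p unfolding lipschitz_free_space_def closure_sequential by blast
  show ?thesis
  proof (rule borel_measurable_LIMSEQ_real)
    show "(\<lambda>n. blinfun_apply (P n) (\<Phi> w)) \<longlonglongrightarrow> blinfun_apply p (\<Phi> w)" for w
      by (intro blinfun.tendsto P(2) tendsto_const)
    show "(\<lambda>w. blinfun_apply (P n) (\<Phi> w)) \<in> borel_measurable M" for n
      using span P(1)[of n] by auto
  qed
qed

lemma lattice_lipschitz_representation:
  assumes const: "\<And>c. (\<lambda>_. c) \<in> X"
    and T: "lattice_lipschitz M X T" and T0: "AE w in M. T (\<lambda>_. 0) w = 0"
  obtains \<Phi> where "\<And>f. f \<in> X \<Longrightarrow> AE w in M. T f w = lip0_fun (\<Phi> w) (f w)"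
proof -
  obtain K where K: "\<And>w. w \<in> space M \<Longrightarrow> 0 \<le> K w"
    and TK: "\<And>f g. f \<in> X \<Longrightarrow> g \<in> X \<Longrightarrow>
      AE w in M. \<bar>T f w - T g w\<bar> \<le> K w * \<bar>f w - g w\<bar>"
    using T unfolding lattice_lipschitz_def by blast
  \<comment> \<open>Where no such \<open>\<phi>\<close> exists the choice is arbitrary; this happens
    only on a null set.\<close>
  define \<Phi> where "\<Phi> w = (SOME \<phi>. \<forall>q\<in>\<rat>. lip0_fun \<phi> q = T (\<lambda>_. q) w)" for w
  \<comment> \<open>Each pair of constants has its own exceptional null set; restricting to
    countably many constants merges them into one.\<close>
  have "AE w in M. \<forall>q\<in>\<rat>. \<forall>r\<in>\<rat>. \<bar>T (\<lambda>_. q) w - T (\<lambda>_. r) w\<bar> \<le> K w * \<bar>q - r\<bar>"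
    by (intro AE_ball_countable' countable_rat TK const)
  with T0 AE_space have \<Phi>: "AE w in M. \<forall>q\<in>\<rat>. lip0_fun (\<Phi> w) q = T (\<lambda>_. q) w"
  proof eventually_elim
    case (elim w)
    then have "(K w)-lipschitz_on \<rat> (\<lambda>q. T (\<lambda>_. q) w)"
      by (intro lipschitz_onI) (auto simp: dist_real_def K)
    then obtain \<phi> where "\<forall>q\<in>\<rat>. lip0_fun \<phi> q = T (\<lambda>_. q) w"
      using elim(1) by (rule lip0_extend_Rats)
    then show ?case
      unfolding \<Phi>_def by (rule someI)
  qed
  show ?thesis
  proof (rule that)
    fix f assume f: "f \<in> X"
    \<comment> \<open>This null set may depend on \<open>f\<close>, while \<open>\<Phi>\<close> was
      fixed using constants alone.\<close>
    have "AE w in M. \<forall>q\<in>\<rat>. \<bar>T f w - T (\<lambda>_. q) w\<bar> \<le> K w * \<bar>f w - q\<bar>"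
      by (intro AE_ball_countable' countable_rat TK f const)
    with \<Phi> show "AE w in M. T f w = lip0_fun (\<Phi> w) (f w)"
    proof eventually_elim
      case (elim w)
      then show ?case
        by (intro lip0_fun_eq_of_Rats_bound[where C = "K w"]) simp
    qed
  qed
qed

lemma lattice_lipschitz_if_representation:
  assumes rep: "\<And>f. f \<in> X \<Longrightarrow> AE w in M. T f w = lip0_fun (\<Phi> w) (f w)"
  shows "lattice_lipschitz M X T"
  unfolding lattice_lipschitz_def
proof (intro exI[of _ "\<lambda>w. norm (\<Phi> w)"] conjI ballI)
  fix f g assume "f \<in> X" "g \<in> X"
  from this[THEN rep]
  show "AE w in M. \<bar>T f w - T g w\<bar> \<le> norm (\<Phi> w) * \<bar>f w - g w\<bar>"
  proof eventually_elim
    case (elim w)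
    then show ?case
      using lipschitz_onD[OF lipschitz_on_norm_lip0, of "f w" "g w" "\<Phi> w"]
      by (simp add: dist_real_def)
  qed
qed simp

text \<open>The condition on \<open>T (\<lambda>_. 0)\<close> accompanies the Lipschitz property
  because every \<open>\<Phi> w\<close> vanishes at 0: the map sending \<open>f\<close> to
  \<open>f + 1\<close> satisfies the Lipschitz estimate with \<open>K = 1\<close> but has no
  representation unless the measure is zero.\<close>

theorem theorem3p9:
  fixes M :: "'a measure"
    and X :: "('a \<Rightarrow> real) set"
    and N :: "('a \<Rightarrow> real) \<Rightarrow> real"
    and T :: "('a \<Rightarrow> real) \<Rightarrow> 'a \<Rightarrow> real"
  assumes "finite_measure M" and "complete_measure M"
    and "banach_function_space M X N"
    and "L0_operator M X T"
  shows "lattice_lipschitz M X T \<and> (AE w in M. T (\<lambda>_. 0) w = 0) \<longleftrightarrow>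
    (\<exists>\<Phi> :: 'a \<Rightarrow> lip0.
      (\<forall>f\<in>X. AE w in M. T f w = lip0_fun (\<Phi> w) (f w)) \<and>
      (\<forall>p\<in>lipschitz_free_space. (\<lambda>w. blinfun_apply p (\<Phi> w)) \<in> borel_measurable M))"
proof -
  interpret banach_function_space M X N by fact
  interpret complete_measure M by fact
  show ?thesis
  proof
    assume "lattice_lipschitz M X T \<and> (AE w in M. T (\<lambda>_. 0) w = 0)"
    then obtain \<Phi> where rep: "\<And>f. f \<in> X \<Longrightarrow> AE w in M. T f w = lip0_fun (\<Phi> w) (f w)"
      using lattice_lipschitz_representation[of X M T] const_mem by blast
    \<comment> \<open>On the constant function \<open>x\<close>, the representation identifies this
      evaluation a.e. with the measurable \<open>T (\<lambda>_. x)\<close>, for every real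
      \<open>x\<close>.\<close>
    have "(\<lambda>w. lip0_fun (\<Phi> w) x) \<in> borel_measurable M" for x
    proof (rule borel_measurable_AE_eq)
      show "T (\<lambda>_. x) \<in> borel_measurable M"
        using assms(4) const_mem by (simp add: L0_operator_def)
    qed (rule rep[OF const_mem])
    then show "\<exists>\<Phi> :: 'a \<Rightarrow> lip0.
      (\<forall>f\<in>X. AE w in M. T f w = lip0_fun (\<Phi> w) (f w)) \<and>
      (\<forall>p\<in>lipschitz_free_space. (\<lambda>w. blinfun_apply p (\<Phi> w)) \<in> borel_measurable M)"
      using rep lipschitz_free_pairing_measurable by blast
  next
    assume "\<exists>\<Phi> :: 'a \<Rightarrow> lip0.
      (\<forall>f\<in>X. AE w in M. T f w = lip0_fun (\<Phi> w) (f w)) \<and>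
      (\<forall>p\<in>lipschitz_free_space. (\<lambda>w. blinfun_apply p (\<Phi> w)) \<in> borel_measurable M)"
    then obtain \<Phi> where rep: "\<And>f. f \<in> X \<Longrightarrow> AE w in M. T f w = lip0_fun (\<Phi> w) (f w)"
      by blast
    then show "lattice_lipschitz M X T \<and> (AE w in M. T (\<lambda>_. 0) w = 0)"
      using lattice_lipschitz_if_representation[OF rep] rep[OF const_mem[of 0]] by simp
  qed
qed

end
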